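(* Assume $1<\alpha<G$. The transformation $\Phi_\alpha$ maps $\Omega_\alpha$ one-to-one onto $\Omega_\alpha$ up to a null-set.
   Context: $G=\frac12(\sqrt5+1)$, $[\cdot]$ in the formula for $d_\alpha$ is the integer part (floor). $I_\alpha=[\alpha-2,\alpha)$. For $x\ne0$, $d_\alpha(x)=2\left[\frac1{2|x|}+\frac{1-\alpha}2\right]+1$ and $\varphi_\alpha(x)=\frac1{|x|}-d_\alpha(x)$, with $\varphi_\alpha(0)=0$; the same formulas are used at $x=\alpha$ (which is not in $I_\alpha$) to define $d_\alpha(\alpha)$ and $\varphi_\alpha(\alpha)=\frac1\alpha-d_\alpha(\alpha)$. With $e(x)=\operatorname{sign}(x)$, define for $x\neq0$ $$\Phi_\alpha(x,y)=\left(\varphi_\alpha(x),\frac1{d_\alpha(x)+e(x)y}\right).$$ Put $\Omega_\alpha=\Omega_{I;\alpha}\cup\Omega_{II;\alpha}\cup\Omega_{III;\alpha}$ with $\Omega_{I;\alpha}=I_\alpha\times[0,2-G)$, $\Omega_{II;\alpha}=(\varphi_\alpha(\alpha),\alpha)\times(2-G,1]$, $\Omega_{III;\alpha}=[\varphi_\alpha(\alpha-2),\alpha)\times[1,G)$. A null-set is a set of Lebesgue measure zero. "One-to-one onto up to a null-set" means that after removing null-sets $N_1,N_2$ from $\Omega_\alpha$, $\Phi_\alpha$ is a bijection from $\Omega_\alpha\setminus N_1$ onto $\Omega_\alpha\setminus N_2$. *)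

theory Defs
  imports "HOL-Analysis.Analysis"
begin

definition G :: real
  where "G = (sqrt 5 + 1) / 2"

definition I :: "real \<Rightarrow> real set"
  where "I \<alpha> = {\<alpha> - 2..<\<alpha>}"

text \<open>
  The digit map is only meaningful for \<open>x \<noteq> 0\<close>; its value at \<open>x = 0\<close> is an artefact of
  division by zero. It is also evaluated at \<open>x = \<alpha>\<close>, which lies outside \<open>I \<alpha>\<close>.
\<close>

definition d :: "real \<Rightarrow> real \<Rightarrow> int"
  where "d \<alpha> x = 2 * \<lfloor>1 / (2 * \<bar>x\<bar>) + (1 - \<alpha>) / 2\<rfloor> + 1"

definition \<phi> :: "real \<Rightarrow> real \<Rightarrow> real"
  where "\<phi> \<alpha> x = (if x = 0 then 0 else 1 / \<bar>x\<bar> - real_of_int (d \<alpha> x))"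

text \<open>
  The map \<open>\<Phi> \<alpha>\<close> is likewise only meaningful off the line \<open>x = 0\<close>, so statements about it
  must exclude that line from the domain.
\<close>

definition \<Phi> :: "real \<Rightarrow> real \<times> real \<Rightarrow> real \<times> real"
  where "\<Phi> \<alpha> = (\<lambda>(x, y). (\<phi> \<alpha> x, 1 / (real_of_int (d \<alpha> x) + sgn x * y)))"

definition \<Omega>\<^sub>I :: "real \<Rightarrow> (real \<times> real) set"
  where "\<Omega>\<^sub>I \<alpha> = I \<alpha> \<times> {0..<2 - G}"

definition \<Omega>\<^sub>I\<^sub>I :: "real \<Rightarrow> (real \<times> real) set"
  where "\<Omega>\<^sub>I\<^sub>I \<alpha> = {\<phi> \<alpha> \<alpha><..<\<alpha>} \<times> {2 - G<..1}"

definition \<Omega>\<^sub>I\<^sub>I\<^sub>I :: "real \<Rightarrow> (real \<times> real) set"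
  where "\<Omega>\<^sub>I\<^sub>I\<^sub>I \<alpha> = {\<phi> \<alpha> (\<alpha> - 2)..<\<alpha>} \<times> {1..<G}"

definition \<Omega> :: "real \<Rightarrow> (real \<times> real) set"
  where "\<Omega> \<alpha> = \<Omega>\<^sub>I \<alpha> \<union> \<Omega>\<^sub>I\<^sub>I \<alpha> \<union> \<Omega>\<^sub>I\<^sub>I\<^sub>I \<alpha>"

end

theory Submission imports Defs begin

text \<open>
  Put \<open>\<beta> = \<phi> \<alpha> \<alpha> = 1/\<alpha> - 1\<close> and \<open>\<gamma> = \<phi> \<alpha> (\<alpha> - 2) = 1/(2 - \<alpha>) - 1\<close>. Everything rests on the
  identity \<open>1/\<bar>\<beta>\<bar> = 1/\<gamma> + 2\<close> together with \<open>G\<^sup>2 = G + 1\<close>. If \<open>\<Phi> \<alpha> (x, y) = (u, v)\<close> then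
  \<open>1/v = d \<plusminus> y\<close> with \<open>d\<close> odd and \<open>0 < y < G < 2\<close>, so \<open>1/v\<close> determines \<open>d\<close>, the sign and \<open>y\<close>, except
  for the ambiguity \<open>d + y = (d + 2) - (2 - y)\<close> with \<open>1 < y < G\<close>. The first reading requires \<open>x \<ge> \<gamma>\<close>,
  i.e. \<open>u + d \<le> 1/\<gamma>\<close>, and the second one \<open>\<beta> < x < 0\<close>, i.e. \<open>u + d + 2 > 1/\<bar>\<beta>\<bar>\<close>; by the identity
  exactly one of them applies.
\<close>

section \<open>Arithmetic of the golden ratio\<close>

lemma G_bounds: "8/5 < G" "G < 17/10"
proof -
  have "11/5 < sqrt 5" "sqrt 5 < 12/5"
    by (rule real_less_rsqrt real_less_lsqrt; simp add: power2_eq_square)+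
  then show "8/5 < G" "G < 17/10"
    unfolding G_def by auto
qed

lemma G_square: "G * G = G + 1"
  unfolding G_def by (simp add: field_simps)

lemma inverse_G_minus_1: "1 / (G - 1) = G"
  using G_square G_bounds by (simp add: field_simps)

lemma inverse_G_plus_1: "1 / (G + 1) = 2 - G"
  using G_square G_bounds by (simp add: field_simps)

section \<open>Digits and the range of \<open>\<phi>\<close>\<close>

lemma odd_d: "odd (d \<alpha> x)"
  by (simp add: d_def)

lemma \<phi>_bounds:
  assumes "x \<noteq> 0"
  shows "\<alpha> - 2 \<le> \<phi> \<alpha> x" "\<phi> \<alpha> x < \<alpha>"
proof -
  define z where "z = 1 / (2 * \<bar>x\<bar>) + (1 - \<alpha>) / 2"
  have "1 / \<bar>x\<bar> = 2 * z + \<alpha> - 1"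
    using assms by (simp add: z_def field_simps)
  then have "\<phi> \<alpha> x = 2 * z + \<alpha> - 1 - (2 * of_int \<lfloor>z\<rfloor> + 1)"
    using assms by (simp add: \<phi>_def d_def flip: z_def)
  then show "\<alpha> - 2 \<le> \<phi> \<alpha> x" "\<phi> \<alpha> x < \<alpha>"
    by linarith+
qed

text \<open>The window \<open>[\<alpha> - 2, \<alpha>)\<close> is half-open of length 2, so only one
  odd integer can shift \<open>1 / \<bar>x\<bar>\<close> into it.\<close>

lemma d_eqI:
  assumes "odd k" "\<alpha> - 2 \<le> 1 / \<bar>x\<bar> - of_int k" "1 / \<bar>x\<bar> - of_int k < \<alpha>"
  shows "d \<alpha> x = k"
proof -
  obtain m where m: "k = 2 * m + 1"
    using assms(1) by (elim oddE)
  have "1 / (2 * \<bar>x\<bar>) = (1 / \<bar>x\<bar>) / 2"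
    by simp
  then have "\<lfloor>1 / (2 * \<bar>x\<bar>) + (1 - \<alpha>) / 2\<rfloor> = m"
    using assms(2,3) unfolding m by (intro floor_unique) (auto simp: field_simps)
  then show ?thesis
    by (simp add: d_def m)
qed

lemma odd_eqI:
  fixes j k :: int
  assumes "odd j" "odd k" "\<bar>j - k\<bar> < 2"
  shows "j = k"
  using assms by presburger

text \<open>Besides the line \<open>x = 0\<close>, two heights spoil injectivity: at
  \<open>y = 0\<close> the sign of \<open>x\<close> is lost, and at \<open>y = 1\<close> the
  readings \<open>d + 1\<close> and \<open>(d + 2) - 1\<close> coincide.\<close>

definition N :: "(real \<times> real) set"
  where "N = {0} \<times> UNIV \<union> UNIV \<times> {0, 1}"

text \<open>
  The heights \<open>v\<close> at which \<open>1/v\<close> differs from an integer by \<open>0\<close>, \<open>1\<close>, \<open>2 - G\<close> or \<open>G\<close>, the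
  boundary heights of the pieces of \<open>\<Omega> \<alpha>\<close>.
\<close>

definition C :: "real set"
  where "C = {v. 1 / v \<in> \<int> \<or> 1 / v + G \<in> \<int> \<or> 1 / v - G \<in> \<int>}"

lemma countable_C: "countable C"
proof -
  have "C \<subseteq> (\<lambda>z. 1 / z) ` \<int> \<union> (\<lambda>z. 1 / (z - G)) ` \<int> \<union> (\<lambda>z. 1 / (z + G)) ` \<int>"
    unfolding C_def by (force simp: image_iff)
  moreover have "countable (\<int> :: real set)"
    by (simp add: Ints_def)
  then have "countable ((\<lambda>z. 1 / z) ` \<int> \<union> (\<lambda>z. 1 / (z - G)) ` \<int> \<union>
      (\<lambda>z. 1 / (z + G)) ` (\<int> :: real set))"
    by (intro countable_Un countable_image)
  ultimately show ?thesis
    by (rule countable_subset)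
qed

lemma UNIV_times_countable_null:
  fixes C :: "real set"
  assumes "countable C"
  shows "(UNIV :: real set) \<times> C \<in> null_sets lebesgue" "C \<times> (UNIV :: real set) \<in> null_sets lebesgue"
proof -
  have "C \<in> null_sets lborel"
    using assms by (rule countable_imp_null_set_lborel)
  then have "(UNIV :: real set) \<times> C \<in> null_sets (lborel \<Otimes>\<^sub>M lborel)"
    "C \<times> (UNIV :: real set) \<in> null_sets (lborel \<Otimes>\<^sub>M lborel)"
    by auto
  then show "(UNIV :: real set) \<times> C \<in> null_sets lebesgue" "C \<times> (UNIV :: real set) \<in> null_sets lebesgue"
    by (auto simp: lborel_prod intro: null_sets_completionI)
qed

section \<open>The endpoints \<open>\<beta>\<close> and \<open>\<gamma>\<close> for a fixed
  \<open>\<alpha>\<close>\<close>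

context
  fixes \<alpha> :: real
  assumes \<alpha>: "1 < \<alpha>" "\<alpha> < G"
begin

definition \<beta> :: real
  where "\<beta> = 1 / \<alpha> - 1"

definition \<gamma> :: real
  where "\<gamma> = 1 / (2 - \<alpha>) - 1"

lemma \<alpha>_less_2: "\<alpha> < 2"
  using \<alpha> G_bounds by simp

text \<open>The product \<open>(t - 1) * t\<close> increases for \<open>t \<ge> 1\<close> and equals
  1 at \<open>t = G\<close>. The bounds that place \<open>\<beta>\<close> and
  \<open>\<gamma>\<close> inside \<open>I \<alpha>\<close> come from this.\<close>

lemma \<alpha>_square: "\<alpha> * \<alpha> < \<alpha> + 1"
proof -
  have "(\<alpha> - 1) * \<alpha> < (G - 1) * G"
    using \<alpha> by (intro mult_strict_mono) auto
  then show ?thesis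
    using G_square by (simp add: algebra_simps)
qed

lemma inverse_\<alpha>_gt: "\<alpha> - 1 < 1 / \<alpha>"
  using \<alpha> \<alpha>_square by (simp add: field_simps)

lemma inverse_2_minus_\<alpha>_less: "1 / (2 - \<alpha>) < \<alpha> + 1"
  using \<alpha>_less_2 \<alpha>_square by (simp add: field_simps)

lemma \<beta>_neg: "\<beta> < 0"
  using \<alpha> by (simp add: \<beta>_def)

lemma \<beta>_gt: "\<alpha> - 2 < \<beta>"
  using inverse_\<alpha>_gt by (simp add: \<beta>_def)

lemma \<gamma>_pos: "0 < \<gamma>"
  using \<alpha> \<alpha>_less_2 by (simp add: \<gamma>_def field_simps)

lemma \<gamma>_less: "\<gamma> < \<alpha>"
  using inverse_2_minus_\<alpha>_less by (simp add: \<gamma>_def)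

text \<open>As fractions, \<open>- \<beta>\<close> and \<open>\<gamma>\<close> share the numerator
  \<open>\<alpha> - 1\<close>, and their denominators \<open>\<alpha>\<close> and
  \<open>2 - \<alpha>\<close> differ by twice that numerator.\<close>

lemma inverse_\<beta>: "1 / (- \<beta>) = 1 / \<gamma> + 2"
proof -
  have *: "- \<beta> = (\<alpha> - 1) / \<alpha>" "\<gamma> = (\<alpha> - 1) / (2 - \<alpha>)"
    using \<alpha> \<alpha>_less_2 by (auto simp: \<beta>_def \<gamma>_def field_simps)
  show ?thesis
    unfolding * using \<alpha> \<alpha>_less_2 by (simp add: field_simps)
qed

lemma inverse_\<gamma>_gt: "1 / \<alpha> < 1 / \<gamma>"
  using \<gamma>_pos \<gamma>_less by (simp add: frac_less2)

lemma \<phi>_\<alpha>: "\<phi> \<alpha> \<alpha> = \<beta>"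
proof -
  have *: "1 / \<bar>\<alpha>\<bar> - of_int 1 = \<beta>"
    using \<alpha> by (simp add: \<beta>_def)
  have "d \<alpha> \<alpha> = 1"
    by (rule d_eqI; (unfold *)?) (use \<alpha> \<beta>_gt \<beta>_neg in auto)
  then show ?thesis
    using \<alpha> * by (simp add: \<phi>_def)
qed

lemma \<phi>_\<alpha>_minus_2: "\<phi> \<alpha> (\<alpha> - 2) = \<gamma>"
proof -
  have *: "1 / \<bar>\<alpha> - 2\<bar> - of_int 1 = \<gamma>"
    using \<alpha>_less_2 by (simp add: \<gamma>_def)
  have "d \<alpha> (\<alpha> - 2) = 1"
    by (rule d_eqI; (unfold *)?) (use \<alpha>_less_2 \<gamma>_pos \<gamma>_less in auto)
  then show ?thesis
    using \<alpha>_less_2 * by (simp add: \<phi>_def)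
qed

lemma mem_\<Omega>_iff:
  "(x, y) \<in> \<Omega> \<alpha> \<longleftrightarrow>
    \<alpha> - 2 \<le> x \<and> x < \<alpha> \<and> 0 \<le> y \<and> y < 2 - G \<or>
    \<beta> < x \<and> x < \<alpha> \<and> 2 - G < y \<and> y \<le> 1 \<or>
    \<gamma> \<le> x \<and> x < \<alpha> \<and> 1 \<le> y \<and> y < G"
  by (auto simp: \<Omega>_def \<Omega>\<^sub>I_def \<Omega>\<^sub>I\<^sub>I_def \<Omega>\<^sub>I\<^sub>I\<^sub>I_def I_def \<phi>_\<alpha> \<phi>_\<alpha>_minus_2)

lemma mem_\<Omega>_minus_N:
  assumes "(x, y) \<in> \<Omega> \<alpha> - N"
  shows "x \<noteq> 0" "\<alpha> - 2 \<le> x" "x < \<alpha>" "0 < y" "y < G" "y \<noteq> 1" "y \<noteq> 2 - G"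
    "2 - G < y \<Longrightarrow> \<beta> < x" "1 < y \<Longrightarrow> \<gamma> \<le> x"
  using assms \<beta>_gt \<beta>_neg \<gamma>_pos G_bounds \<alpha> \<alpha>_less_2 by (auto simp: mem_\<Omega>_iff N_def)

section \<open>Invariance of \<open>\<Omega> \<alpha>\<close>\<close>

lemma d_ge_1:
  assumes "x \<noteq> 0" "\<alpha> - 2 \<le> x" "x < \<alpha>"
  shows "1 \<le> d \<alpha> x"
proof -
  have "1 / \<alpha> < 1 / \<bar>x\<bar>"
    using assms \<alpha> by (intro divide_strict_left_mono) auto
  \<comment> \<open>From \<open>\<phi> \<alpha> x < \<alpha>\<close> the digit exceeds
    \<open>1 / \<alpha> - \<alpha>\<close>, which is above -1; oddness then excludes 0.\<close>
  then have "of_int (d \<alpha> x) > (- 1 :: real)"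
    using assms(1) inverse_\<alpha>_gt \<phi>_bounds(2)[of x \<alpha>] by (simp add: \<phi>_def)
  then have "- 1 < d \<alpha> x"
    by linarith
  moreover have "d \<alpha> x \<noteq> 0"
    using odd_d[of \<alpha> x] by auto
  ultimately show ?thesis
    by linarith
qed

lemma inverse_abs_gt:
  assumes "\<beta> < x" "x < 0"
  shows "1 / \<gamma> + 2 < 1 / \<bar>x\<bar>"
  unfolding inverse_\<beta>[symmetric] using assms by (intro divide_strict_left_mono) (auto simp: mult_neg_neg)

text \<open>For the denominator \<open>w\<close> of the new height, the three pieces correspond to
  \<open>w > 1 + G\<close>, \<open>1 < w < 1 + G\<close> and \<open>G - 1 < w < 1\<close>, because
  \<open>1 / (G + 1) = 2 - G\<close> and \<open>1 / (G - 1) = G\<close>. The sign of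
  \<open>x\<close> and the digit \<open>k\<close> decide which range occurs.\<close>

lemma \<Phi>_in_\<Omega>:
  assumes xy: "(x, y) \<in> \<Omega> \<alpha> - N"
  shows "\<Phi> \<alpha> (x, y) \<in> \<Omega> \<alpha>"
proof -
  note m = mem_\<Omega>_minus_N[OF xy]
  define k where "k = d \<alpha> x"
  define u where "u = \<phi> \<alpha> x"
  define w where "w = of_int k + sgn x * y"
  have u: "\<alpha> - 2 \<le> u" "u < \<alpha>" "u = 1 / \<bar>x\<bar> - of_int k"
    using \<phi>_bounds[OF m(1), of \<alpha>] m(1) by (auto simp: u_def k_def \<phi>_def)
  have k: "odd k" "1 \<le> k"
    using odd_d d_ge_1[OF m(1-3)] by (auto simp: k_def)
  have "(u, 1 / w) \<in> \<Omega> \<alpha>" if "w > 1 + G"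
  proof -
    have "1 / w < 1 / (G + 1)"
      using that G_bounds by (intro divide_strict_left_mono) auto
    then show ?thesis
      using u that inverse_G_plus_1 G_bounds by (auto simp: mem_\<Omega>_iff)
  qed
  moreover have "(u, 1 / w) \<in> \<Omega> \<alpha>" if "1 < w" "w < 1 + G" "\<beta> < u"
  proof -
    have "1 / (G + 1) < 1 / w" "1 / w \<le> 1"
      using that G_bounds by (auto intro!: divide_strict_left_mono)
    then show ?thesis
      using u that inverse_G_plus_1 by (auto simp: mem_\<Omega>_iff)
  qed
  moreover have "(u, 1 / w) \<in> \<Omega> \<alpha>" if "w < 1" "G - 1 < w" "\<gamma> \<le> u"
  proof -
    have "1 / w < 1 / (G - 1)" "1 \<le> 1 / w"
      using that G_bounds by (auto intro!: divide_strict_left_mono)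
    then show ?thesis
      using u that inverse_G_minus_1 by (auto simp: mem_\<Omega>_iff)
  qed
  moreover have "w > 1 + G \<or> 1 < w \<and> w < 1 + G \<and> \<beta> < u \<or> w < 1 \<and> G - 1 < w \<and> \<gamma> \<le> u"
  proof (cases "x > 0")
    case True
    have "1 / \<alpha> < 1 / \<bar>x\<bar>"
      using True m by (intro divide_strict_left_mono) auto
    then have "\<beta> < u" if "k = 1"
      using that u(3) by (simp add: \<beta>_def)
    moreover have "k = 1 \<or> 3 \<le> k"
      using k by presburger
    ultimately show ?thesis
      using m True G_bounds by (auto simp: w_def)
  next
    case False
    with m have x: "x < 0"
      by simp
    \<comment> \<open>Above height 1 only the third piece remains, and it lies over
      \<open>x \<ge> \<gamma> > 0\<close>.\<close>
    then have y: "y < 1"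
      using m \<gamma>_pos by force
    have w: "w = of_int k - y"
      using x by (simp add: w_def)
    have high: "1 / \<gamma> + 2 < 1 / \<bar>x\<bar>" if "2 - G < y"
      using inverse_abs_gt m x that by auto
    have "k = 1 \<or> k = 3 \<or> 5 \<le> k"
      using k by presburger
    then consider "k = 1" | "k = 3" | "5 \<le> k"
      by blast
    then show ?thesis
    proof cases
      case 1
      have "1 / (2 - \<alpha>) \<le> 1 / \<bar>x\<bar>"
        using x m \<alpha>_less_2 by (intro divide_left_mono) (auto simp: mult_pos_neg)
      \<comment> \<open>Otherwise \<open>1 / \<bar>x\<bar> > 1 / \<gamma> + 2 > 1 / \<alpha> + 2 >
        \<alpha> + 1\<close>, and \<open>u = 1 / \<bar>x\<bar> - 1\<close> would exceed
        \<open>\<alpha>\<close>.\<close>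
      moreover have "y < 2 - G"
        using high 1 u inverse_\<gamma>_gt inverse_\<alpha>_gt m by force
      ultimately show ?thesis
        using 1 u(3) w m by (auto simp: \<gamma>_def)
    next
      case 2
      \<comment> \<open>Here \<open>w = 3 - y\<close>, so \<open>y < 2 - G\<close> means
        \<open>w > 1 + G\<close>. For larger \<open>y\<close>, \<open>high\<close> gives
        \<open>u > 1 / \<gamma> - 1 > 1 / \<alpha> - 1 = \<beta>\<close>.\<close>
      show ?thesis
      proof (cases "y < 2 - G")
        case False
        then have "\<beta> < u"
          using high 2 u(3) inverse_\<gamma>_gt m by (auto simp: \<beta>_def)
        then show ?thesis
          using 2 False m y w by auto
      qed (use 2 w in auto)
    next
      case 3
      then have "5 \<le> (of_int k :: real)"
        by simp
      then show ?thesis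
        using w y G_bounds by auto
    qed
  qed
  ultimately show ?thesis
    unfolding \<Phi>_def by (auto simp: u_def k_def w_def)
qed

section \<open>Injectivity\<close>

text \<open>The ambiguous case of the digit expansion, excluded by \<open>1/\<bar>\<beta>\<bar> = 1/\<gamma> + 2\<close>.\<close>

lemma \<Phi>_eq_opposite_signs:
  assumes xy: "(x, y) \<in> \<Omega> \<alpha> - N" and xy': "(x', y') \<in> \<Omega> \<alpha> - N"
    and "\<phi> \<alpha> x = \<phi> \<alpha> x'"
    and w: "of_int (d \<alpha> x) + sgn x * y = of_int (d \<alpha> x') + sgn x' * y'"
    and "0 < x" "x' < 0"
  shows False
proof -
  note m = mem_\<Omega>_minus_N[OF xy] and m' = mem_\<Omega>_minus_N[OF xy']
  have y': "y' < 1"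
    using m' assms \<gamma>_pos by force
  \<comment> \<open>A difference of two odd digits that lies strictly between 0 and 4 must be
    2.\<close>
  have sum: "y + y' = of_int (d \<alpha> x' - d \<alpha> x)"
    using w assms by simp
  moreover have "0 < y + y'" "y + y' < 4"
    using m m' G_bounds by auto
  ultimately have "0 < d \<alpha> x' - d \<alpha> x" "d \<alpha> x' - d \<alpha> x < 4"
    by linarith+
  moreover have "even (d \<alpha> x' - d \<alpha> x)"
    by (simp add: odd_d)
  ultimately have d: "d \<alpha> x' = d \<alpha> x + 2"
    by presburger
  then have y: "y + y' = 2"
    using sum by simp
  \<comment> \<open>Since \<open>y' < 1\<close>, the height \<open>y = 2 - y'\<close> is above 1;
    since \<open>y < G\<close>, the height \<open>y'\<close> is above \<open>2 - G\<close>.\<close>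
  then have "\<gamma> \<le> x" "\<beta> < x'"
    using m m' y' by auto
  then have "1 / x \<le> 1 / \<gamma>" "1 / \<gamma> + 2 < 1 / \<bar>x'\<bar>"
    using \<gamma>_pos assms inverse_abs_gt by (auto intro!: divide_left_mono)
  moreover have "1 / x + 2 = 1 / \<bar>x'\<bar>"
    using assms d by (auto simp: \<phi>_def)
  ultimately show False
    by simp
qed

text \<open>Once the signs agree, the digits differ by an even number of absolute value
  \<open>\<bar>y - y'\<bar> < 2\<close>, hence not at all.\<close>

lemma inj_on_\<Phi>: "inj_on (\<Phi> \<alpha>) (\<Omega> \<alpha> - N)"
proof (rule inj_onI, clarify)
  fix x y x' y'
  assume "(x, y) \<in> \<Omega> \<alpha>" "(x, y) \<notin> N" "(x', y') \<in> \<Omega> \<alpha>" "(x', y') \<notin> N"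
    and eq: "\<Phi> \<alpha> (x, y) = \<Phi> \<alpha> (x', y')"
  then have xy: "(x, y) \<in> \<Omega> \<alpha> - N" and xy': "(x', y') \<in> \<Omega> \<alpha> - N"
    by auto
  note m = mem_\<Omega>_minus_N[OF xy] and m' = mem_\<Omega>_minus_N[OF xy']
  have \<phi>: "\<phi> \<alpha> x = \<phi> \<alpha> x'"
    and w: "of_int (d \<alpha> x) + sgn x * y = of_int (d \<alpha> x') + sgn x' * y'"
    using eq by (auto simp: \<Phi>_def)
  have "0 < x \<longleftrightarrow> 0 < x'"
    using \<Phi>_eq_opposite_signs[OF xy xy' \<phi> w]
      \<Phi>_eq_opposite_signs[OF xy' xy \<phi>[symmetric] w[symmetric]]
      m(1) m'(1) by (metis linorder_neqE_linordered_idom)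
  then have sgn: "sgn x = sgn x'"
    using m(1) m'(1) by (auto simp: sgn_if)
  have "\<bar>y - y'\<bar> < 2"
    using m m' G_bounds by auto
  moreover have "\<bar>y - y'\<bar> = \<bar>of_int (d \<alpha> x - d \<alpha> x')\<bar>"
    using w sgn m(1) m'(1) by (auto simp: sgn_if split: if_splits)
  ultimately have "\<bar>d \<alpha> x - d \<alpha> x'\<bar> < 2"
    by linarith
  then have d: "d \<alpha> x = d \<alpha> x'"
    using odd_eqI odd_d by blast
  then have "\<bar>x\<bar> = \<bar>x'\<bar>"
    using \<phi> m(1) m'(1) by (simp add: \<phi>_def)
  then have "x = x'"
    using sgn by (metis mult_sgn_abs)
  moreover have "y = y'"
    using w sgn d m(1) m'(1) by (auto simp: sgn_if split: if_splits)
  ultimately show "x = x' \<and> y = y'"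
    by simp
qed

section \<open>Inverse branches and surjectivity up to a null-set\<close>

lemma image_\<Phi>I:
  fixes s :: real
  assumes "odd k" "\<alpha> - 2 \<le> u" "u < \<alpha>" "0 < u + of_int k"
    and s: "s = 1 \<or> s = - 1"
    and "(s / (u + of_int k), y) \<in> \<Omega> \<alpha>" "y \<noteq> 0" "y \<noteq> 1"
    and v: "1 / v = of_int k + s * y"
  shows "(u, v) \<in> \<Phi> \<alpha> ` (\<Omega> \<alpha> - N)"
proof
  define x where "x = s / (u + of_int k)"
  have x: "x \<noteq> 0" "1 / \<bar>x\<bar> = u + of_int k" "sgn x = s"
    using s assms(4) by (auto simp: x_def)
  have "d \<alpha> x = k"
    using assms x by (intro d_eqI) auto
  then show "(u, v) = \<Phi> \<alpha> (x, y)"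
    using x v[symmetric] by (simp add: \<Phi>_def \<phi>_def)
  show "(x, y) \<in> \<Omega> \<alpha> - N"
    using assms x by (auto simp: N_def x_def)
qed

text \<open>Split \<open>1 / v = k + t\<close> with \<open>k\<close> odd and
  \<open>G - 2 < t < G\<close>. The sign of \<open>t\<close> gives the sign of \<open>x\<close>,
  with \<open>y = \<bar>t\<bar>\<close>, unless \<open>t > 1\<close> and the resulting
  \<open>x\<close> is below \<open>\<gamma>\<close>; then the reading
  \<open>(k + 2) - (2 - t)\<close> supplies the preimage.\<close>

lemma \<Omega>_subset_image:
  assumes uv: "(u, v) \<in> \<Omega> \<alpha>" and "v \<notin> C"
  shows "(u, v) \<in> \<Phi> \<alpha> ` (\<Omega> \<alpha> - N)"
proof -
  define w where "w = 1 / v"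
  have w: "w \<notin> \<int>" "w + G \<notin> \<int>" "w - G \<notin> \<int>"
    using \<open>v \<notin> C\<close> by (auto simp: C_def w_def)
  \<comment> \<open>Since \<open>1 / 0 = 0\<close> is an integer, \<open>v = 0\<close> belongs to
    \<open>C\<close>.\<close>
  have "v \<noteq> 0"
    using w by (auto simp: w_def)
  then have v: "0 < v" "v < G"
    using uv G_bounds by (auto simp: mem_\<Omega>_iff)
  have u: "\<alpha> - 2 \<le> u" "u < \<alpha>"
    using uv inverse_\<alpha>_gt \<gamma>_pos \<alpha>_less_2 by (auto simp: mem_\<Omega>_iff \<beta>_def)
  have "1 / G < 1 / v"
    using v by (intro divide_strict_left_mono) auto
  moreover have "1 / G = G - 1"
    using G_square G_bounds by (simp add: field_simps)
  ultimately have w_gt: "G - 1 < w"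
    by (simp add: w_def)
  \<comment> \<open>The floor puts \<open>t\<close> into \<open>[G - 2, G)\<close>: a negative
    \<open>t\<close> then yields a height below \<open>2 - G\<close>, where the whole of
    \<open>I \<alpha>\<close> is available, and a positive \<open>t\<close> stays below
    \<open>G\<close>.\<close>
  define k where "k = 2 * \<lfloor>(w - G + 1) / 2\<rfloor> + 1"
  define t where "t = w - of_int k"
  have "G - 2 \<le> t" "t < G"
    using floor_correct[of "(w - G + 1) / 2"] by (auto simp: t_def k_def field_simps)
  moreover have "t \<noteq> G - 2"
  proof
    assume "t = G - 2"
    then have "w - G = of_int (k - 2)"
      by (simp add: t_def)
    then show False
      using w(3) by (metis Ints_of_int)
  qed
  moreover have "t \<noteq> 0" "t \<noteq> 1"
    using w(1) by (auto simp: t_def diff_eq_eq)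
  moreover have "t \<noteq> 2 - G"
  proof
    assume "t = 2 - G"
    then have "w + G = of_int (k + 2)"
      by (simp add: t_def)
    then show False
      using w(2) by (metis Ints_of_int)
  qed
  ultimately have t: "G - 2 < t" "t < G" "t \<noteq> 0" "t \<noteq> 1" "t \<noteq> 2 - G"
    by auto
  have k: "odd k" "1 \<le> k"
  proof -
    show "odd k"
      by (simp add: k_def)
    have "- 1 < (of_int k :: real)"
      using w_gt t by (simp add: t_def)
    then have "- 1 < k"
      by linarith
    then show "1 \<le> k"
      using \<open>odd k\<close> by presburger
  qed
  have wt: "w = of_int k + t"
    by (simp add: t_def)
  \<comment> \<open>For digit 1, \<open>\<beta> < u\<close> says exactly that the preimage has
    \<open>\<bar>x\<bar> < \<alpha>\<close>.\<close>
  have u1: "\<beta> < u" if "k = 1"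
  proof -
    have "w < G + 1"
      using wt t that by simp
    then have "1 / (G + 1) < 1 / w"
      using w_gt G_bounds by (intro divide_strict_left_mono) auto
    then have "2 - G < v"
      by (simp add: w_def inverse_G_plus_1)
    then show ?thesis
      using uv \<beta>_neg \<gamma>_pos by (auto simp: mem_\<Omega>_iff)
  qed
  \<comment> \<open>Likewise \<open>\<gamma> \<le> u\<close> says that \<open>- 1 / (u + 1)\<close>
    is at least \<open>\<alpha> - 2\<close>.\<close>
  have u2: "\<gamma> \<le> u" if "k = 1" "t < 0"
  proof -
    have "w < 1"
      using wt that by simp
    then have "1 < v"
      using v by (simp add: w_def field_simps)
    then show ?thesis
      using uv G_bounds by (auto simp: mem_\<Omega>_iff)
  qed
  have uk3: "\<alpha> + 1 \<le> u + of_int k" if "k \<noteq> 1"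
  proof -
    have "3 \<le> k"
      using k that by presburger
    then have "3 \<le> (of_int k :: real)"
      by simp
    then show ?thesis
      using u by simp
  qed
  have uk: "1 / \<alpha> < u + of_int k"
    using u1 uk3 \<alpha> inverse_\<alpha>_gt by (cases "k = 1") (auto simp: \<beta>_def intro: less_le_trans[of _ 1])
  moreover have "0 < 1 / \<alpha>"
    using \<alpha> by simp
  ultimately have pos: "0 < u + of_int k"
    by linarith
  define r where "r = 1 / (u + of_int k)"
  have r: "0 < r" "r < \<alpha>"
    using uk pos \<alpha> by (auto simp: r_def field_simps)
  consider "t < 0" | "0 < t" "t < 2 - G" | "2 - G < t" "t < 1" | "1 < t"
    using t by linarith
  then show ?thesis
  proof cases
    case 1
    have "1 / (2 - \<alpha>) \<le> u + of_int k"
      using u2 uk3 inverse_2_minus_\<alpha>_less 1 by (cases "k = 1") (auto simp: \<gamma>_def)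
    then have "r \<le> 2 - \<alpha>"
      using pos \<alpha>_less_2 by (simp add: r_def field_simps)
    then have "(- r, - t) \<in> \<Omega> \<alpha>"
      using 1 t r \<alpha> by (auto simp: mem_\<Omega>_iff)
    then show ?thesis
      using k u pos 1 t wt G_bounds
      by (intro image_\<Phi>I[where k = k and s = "- 1" and y = "- t"]) (auto simp: w_def r_def)
  next
    case 2
    then have "(r, t) \<in> \<Omega> \<alpha>"
      using r \<alpha>_less_2 by (auto simp: mem_\<Omega>_iff)
    then show ?thesis
      using k u pos t wt by (intro image_\<Phi>I[where k = k and s = 1 and y = t]) (auto simp: w_def r_def)
  next
    case 3
    then have "(r, t) \<in> \<Omega> \<alpha>"
      using r \<beta>_neg by (auto simp: mem_\<Omega>_iff)
    then show ?thesis
      using k u pos t wt by (intro image_\<Phi>I[where k = k and s = 1 and y = t]) (auto simp: w_def r_def)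
  next
    case 4
    show ?thesis
    proof (cases "\<gamma> \<le> r")
      case True
      then have "(r, t) \<in> \<Omega> \<alpha>"
        using 4 t r by (auto simp: mem_\<Omega>_iff)
      then show ?thesis
        using k u pos t wt by (intro image_\<Phi>I[where k = k and s = 1 and y = t]) (auto simp: w_def r_def)
    next
      case False
      then have "1 / \<gamma> < u + of_int k"
        using pos \<gamma>_pos by (simp add: r_def field_simps)
      \<comment> \<open>Raising the digit by 2 moves the bound \<open>1 / \<gamma>\<close> to
        \<open>1 / (- \<beta>)\<close>, so \<open>- q > \<beta>\<close>; as \<open>2 - t\<close>
        lies between \<open>2 - G\<close> and 1, the new point is in the second piece.\<close>
      then have *: "1 / (- \<beta>) < u + of_int (k + 2)"
        using inverse_\<beta> by simp
      define q where "q = 1 / (u + of_int (k + 2))"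
      have "q < 1 / (1 / (- \<beta>))"
        unfolding q_def using * \<beta>_neg by (intro divide_strict_left_mono)
          (use pos in \<open>auto simp: divide_pos_neg\<close>)
      moreover have "0 < q"
        using pos by (simp add: q_def)
      ultimately have "(- q, 2 - t) \<in> \<Omega> \<alpha>"
        using 4 t \<alpha> by (auto simp: mem_\<Omega>_iff)
      then show ?thesis
        using k u pos t 4 wt G_bounds
        by (intro image_\<Phi>I[where k = "k + 2" and s = "- 1" and y = "2 - t"]) (auto simp: w_def q_def)
    qed
  qed
qed

end

theorem lemma3:
  fixes \<alpha> :: real
  assumes "1 < \<alpha>" and "\<alpha> < G"
  shows "\<exists>N\<^sub>1 N\<^sub>2. N\<^sub>1 \<in> null_sets lebesgue \<and> N\<^sub>2 \<in> null_sets lebesgue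
           \<and> (\<forall>(x, y) \<in> \<Omega> \<alpha> - N\<^sub>1. x \<noteq> 0)
           \<and> bij_betw (\<Phi> \<alpha>) (\<Omega> \<alpha> - N\<^sub>1) (\<Omega> \<alpha> - N\<^sub>2)"
proof (intro exI conjI)
  let ?N\<^sub>2 = "\<Omega> \<alpha> - \<Phi> \<alpha> ` (\<Omega> \<alpha> - N)"
  show "N \<in> null_sets lebesgue"
    unfolding N_def by (intro null_sets.Un UNIV_times_countable_null) auto
  \<comment> \<open>The second null-set is what the image misses, so removing it leaves exactly the
    image. Completeness of Lebesgue measure makes it null as a subset of
    \<open>UNIV \<times> C\<close>.\<close>
  have "?N\<^sub>2 \<subseteq> UNIV \<times> C"
    using \<Omega>_subset_image[OF assms] by auto
  then show "?N\<^sub>2 \<in> null_sets lebesgue"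
    by (rule null_sets_completion_subset[OF _ UNIV_times_countable_null(1)[OF countable_C]])
  show "\<forall>(x, y) \<in> \<Omega> \<alpha> - N. x \<noteq> 0"
    by (auto simp: N_def)
  have "\<Phi> \<alpha> ` (\<Omega> \<alpha> - N) \<subseteq> \<Omega> \<alpha>"
    using \<Phi>_in_\<Omega>[OF assms] by auto
  then show "bij_betw (\<Phi> \<alpha>) (\<Omega> \<alpha> - N) (\<Omega> \<alpha> - ?N\<^sub>2)"
    using inj_on_\<Phi>[OF assms] by (simp add: bij_betw_def Diff_Diff_Int Int_absorb1)
qed

end
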